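(* Let $A\in\mathbb{C}^{n\times n}$ and $r_0\in\mathbb{C}^n$. Let $\mathcal{U},\widetilde{\mathcal{U}}\subseteq\mathbb{C}^n$ be $k$-dimensional subspaces, let $\mathcal{V}_j\subseteq\mathbb{C}^n$ be a $j$-dimensional Krylov subspace generated by $A$, and let $\widetilde{\mathcal{V}}_j\subseteq\mathbb{C}^n$ be a $j$-dimensional subspace (so the augmented method has search space $\mathcal{V}_j+\mathcal{U}$ and constraint space $\widetilde{\mathcal{V}}_j+\widetilde{\mathcal{U}}$). Let $U,\widetilde U\in\mathbb{C}^{n\times k}$ have columns forming bases of $\mathcal{U},\widetilde{\mathcal{U}}$, assume $\widetilde U^*AU$ is invertible, and put $\Phi:=AU(\widetilde U^*AU)^{-1}\widetilde U^*$. If $A\,\mathcal{U}\perp\widetilde{\mathcal{V}}_j$, then the problem find $t_j\in\mathcal{V}_j$ such that $r_0-At_j\perp(I-\Phi)^*\widetilde{\mathcal{V}}_j$ is equivalent to applying the corresponding standard (non-augmented) Krylov subspace method to the unprojected equation $At=r_0$, i.e. to the problem find $t_j\in\mathcal{V}_j$ such that $r_0-At_j\perp\widetilde{\mathcal{V}}_j$, meaning that a vector $t_j\in\mathcal{V}_j$ solves one of these problems if and only if it solves the other.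
   Context: $I$ is the $n\times n$ identity, ${}^*$ denotes conjugate transpose, and $\perp$ is orthogonality with respect to the standard Hermitian inner product on $\mathbb{C}^n$. A Krylov subspace generated by $A$ is $\mathcal{K}_j(A,w)=\operatorname{span}\{w,Aw,\dots,A^{j-1}w\}$ for a vector $w\in\mathbb{C}^n$ (the natural choice is $w=r_0$). $A\,\mathcal{U}$ is the image of $\mathcal{U}$ under $A$, and $(I-\Phi)^*\widetilde{\mathcal{V}}_j$ is the image of $\widetilde{\mathcal{V}}_j$ under $(I-\Phi)^*$. An unprojected augmented Krylov subspace method with search space $\mathcal{V}_j+\mathcal{U}$ and constraint space $\widetilde{\mathcal{V}}_j+\widetilde{\mathcal{U}}$ seeks a correction from $\mathcal{V}_j+\mathcal{U}$ whose residual is orthogonal to $\widetilde{\mathcal{V}}_j+\widetilde{\mathcal{U}}$; its component $t_j\in\mathcal{V}_j$ is determined by the first problem in the claim. The corresponding standard Krylov subspace method is the non-augmented method with search space $\mathcal{V}_j$ and constraint space $\widetilde{\mathcal{V}}_j$. *)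

theory Defs
  imports
    "Jordan_Normal_Form.VS_Connect"
    "Jordan_Normal_Form.Schur_Decomposition"
    "Jordan_Normal_Form.Gauss_Jordan_Elimination"
begin

abbreviation Cn :: "nat \<Rightarrow> (complex, complex vec) module" where
  "Cn n \<equiv> module_vec TYPE(complex) n"

text \<open>The subspace \<open>W\<close> viewed as a vector space of its own.\<close>

abbreviation sub_vs :: "nat \<Rightarrow> complex vec set \<Rightarrow> (complex, complex vec) module" where
  "sub_vs n W \<equiv> (Cn n)\<lparr>carrier := W\<rparr>"

definition is_subspace_dim :: "nat \<Rightarrow> nat \<Rightarrow> complex vec set \<Rightarrow> bool" where
  "is_subspace_dim n d W \<longleftrightarrow>
     VectorSpace.subspace class_ring W (Cn n) \<and> vectorspace.dim class_ring (sub_vs n W) = d"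

text \<open>\<open>basis\<close> is a predicate on sets, so distinctness of the columns must be required separately.\<close>

definition columns_form_basis :: "nat \<Rightarrow> complex mat \<Rightarrow> complex vec set \<Rightarrow> bool" where
  "columns_form_basis n M W \<longleftrightarrow>
     distinct (cols M) \<and> vectorspace.basis class_ring (sub_vs n W) (set (cols M))"

definition krylov_space :: "nat \<Rightarrow> nat \<Rightarrow> complex mat \<Rightarrow> complex vec \<Rightarrow> complex vec set" where
  "krylov_space n j A w = LinearCombinations.module.span class_ring (Cn n) {(A ^\<^sub>m i) *\<^sub>v w | i. i < j}"

definition mat_image :: "complex mat \<Rightarrow> complex vec set \<Rightarrow> complex vec set" where
  "mat_image M W = (\<lambda>v. M *\<^sub>v v) ` W"

definition orth_vec :: "complex vec \<Rightarrow> complex vec set \<Rightarrow> bool" where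
  "orth_vec x W \<longleftrightarrow> (\<forall>v\<in>W. x \<bullet>c v = 0)"

definition orth_set :: "complex vec set \<Rightarrow> complex vec set \<Rightarrow> bool" where
  "orth_set S W \<longleftrightarrow> (\<forall>x\<in>S. orth_vec x W)"

text \<open>\<open>mat_inverse M\<close> is \<open>None\<close> precisely when the square matrix \<open>M\<close> is singular; the value of
  \<open>aug_Phi\<close> is only meaningful when \<open>Ut\<^sup>* A U\<close> is invertible.\<close>

definition aug_Phi :: "complex mat \<Rightarrow> complex mat \<Rightarrow> complex mat \<Rightarrow> complex mat" where
  "aug_Phi A U Ut =
     A * U * the (mat_inverse (mat_adjoint Ut * A * U)) * mat_adjoint Ut"

text \<open>\<open>t\<close> solves: find \<open>t\<close> in the search space \<open>S\<close> such that \<open>r - A t\<close> is orthogonal to the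
  constraint space \<open>C\<close>. With \<open>S\<close> a Krylov space this is the standard (non-augmented) method
  applied to \<open>A t = r\<close>.\<close>

definition solves_problem ::
  "complex mat \<Rightarrow> complex vec \<Rightarrow> complex vec set \<Rightarrow> complex vec set \<Rightarrow> complex vec \<Rightarrow> bool" where
  "solves_problem A r S C t \<longleftrightarrow> t \<in> S \<and> orth_vec (r - A *\<^sub>v t) C"

end

theory Submission
  imports Defs
begin

text \<open>The adjoint moves the projector off the constraint space: the residual \<open>r\<close> is orthogonal to
  \<open>(I - \<Phi>)\<^sup>* Vt\<close> exactly when \<open>(I - \<Phi>) r = r - \<Phi> r\<close> is orthogonal to \<open>Vt\<close>
  (lemma \<open>orth_vec_mat_image_adjoint\<close>). The leftmost factors of \<open>\<Phi>\<close> are \<open>A U\<close>, so \<open>\<Phi> r\<close> lies in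
  \<open>A Us\<close> for every \<open>r\<close> (lemma \<open>aug_Phi_range\<close>), and that space is orthogonal to \<open>Vt\<close> by hypothesis.
  Hence \<open>\<Phi> r\<close> contributes nothing to the inner products with \<open>Vt\<close>, and the two orthogonality
  conditions agree for every residual, in particular for \<open>r0 - A t\<close>.\<close>

lemma mat_adjoint_carrier:
  assumes "M \<in> carrier_mat m n"
  shows "mat_adjoint M \<in> carrier_mat n m"
  using assms mat_of_rows_carrier(1)[of m "map conjugate (cols M)"]
  unfolding mat_adjoint_def by simp

lemma mat_adjoint_index:
  assumes "M \<in> carrier_mat m n" "i < n" "l < m"
  shows "mat_adjoint M $$ (i, l) = conjugate (M $$ (l, i))"
  using assms unfolding mat_adjoint_def by (auto simp: mat_of_rows_index)

lemma cscalar_prod_mat_adjoint: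
  fixes M :: "complex mat"
  assumes M: "M \<in> carrier_mat m n" and x: "x \<in> carrier_vec n" and v: "v \<in> carrier_vec m"
  shows "x \<bullet>c (mat_adjoint M *\<^sub>v v) = (M *\<^sub>v x) \<bullet>c v"
proof -
  have "x \<bullet>c (mat_adjoint M *\<^sub>v v)
      = (\<Sum>i<n. \<Sum>l<m. x $ i * (M $$ (l, i) * conjugate (v $ l)))"
    using assms mat_adjoint_carrier[OF M]
    by (auto simp: scalar_prod_def mat_adjoint_index[OF M] sum_distrib_left lessThan_atLeast0
        intro!: sum.cong)
  also have "\<dots> = (\<Sum>l<m. \<Sum>i<n. x $ i * (M $$ (l, i) * conjugate (v $ l)))"
    by (rule sum.swap)
  also have "\<dots> = (M *\<^sub>v x) \<bullet>c v"
    using assms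
    by (auto simp: scalar_prod_def sum_distrib_left sum_distrib_right lessThan_atLeast0
        mult_ac intro!: sum.cong)
  finally show ?thesis .
qed

lemma orth_vec_mat_image_adjoint:
  assumes "M \<in> carrier_mat m n" "x \<in> carrier_vec n" "W \<subseteq> carrier_vec m"
  shows "orth_vec x (mat_image (mat_adjoint M) W) \<longleftrightarrow> orth_vec (M *\<^sub>v x) W"
proof -
  have "x \<bullet>c (mat_adjoint M *\<^sub>v v) = (M *\<^sub>v x) \<bullet>c v" if "v \<in> W" for v
    using cscalar_prod_mat_adjoint[OF assms(1,2)] that assms(3) by auto
  then show ?thesis
    unfolding orth_vec_def mat_image_def by simp
qed

lemma orth_vec_diff_iff:
  assumes "x \<in> carrier_vec n" "y \<in> carrier_vec n" "W \<subseteq> carrier_vec n" "orth_vec y W"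
  shows "orth_vec (x - y) W \<longleftrightarrow> orth_vec x W"
proof -
  have "(x - y) \<bullet>c v = x \<bullet>c v" if "v \<in> W" for v
  proof -
    from that assms have "conjugate v \<in> carrier_vec n" "y \<bullet>c v = 0"
      by (auto simp: orth_vec_def)
    with assms(1,2) show ?thesis
      by (simp add: minus_scalar_prod_distrib)
  qed
  then show ?thesis
    unfolding orth_vec_def by simp
qed

lemma is_subspace_dim_submodule:
  "is_subspace_dim n d W \<Longrightarrow> submodule class_ring W (Cn n)"
  unfolding is_subspace_dim_def VectorSpace.subspace_def by simp

lemma is_subspace_dim_carrier:
  "is_subspace_dim n d W \<Longrightarrow> W \<subseteq> carrier_vec n"
  using submodule.subset[OF is_subspace_dim_submodule] by (simp add: module_vec_simps)

lemma columns_form_basis_subset: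
  assumes W: "is_subspace_dim n d W" and U: "columns_form_basis n U W"
  shows "set (cols U) \<subseteq> W"
proof -
  interpret vec_space "TYPE(complex)" n .
  have "vectorspace class_ring (sub_vs n W)"
    using W vectorspace.subspace_is_vs[OF vec_vs]
    unfolding is_subspace_dim_def by auto
  from vectorspace.basis_def[OF this] U show ?thesis
    unfolding columns_form_basis_def by auto
qed

lemma krylov_space_carrier:
  assumes "A \<in> carrier_mat n n" "w \<in> carrier_vec n"
  shows "krylov_space n j A w \<subseteq> carrier_vec n"
proof -
  interpret vec_space "TYPE(complex)" n .
  show ?thesis
    unfolding krylov_space_def using assms
    by (intro span_is_subset2) (auto intro!: mult_mat_vec_carrier[where n=n] pow_carrier_mat)
qed

lemma mult_mat_vec_in_subspace:
  assumes W: "is_subspace_dim n d W" and cols: "set (cols U) \<subseteq> W"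
    and U: "U \<in> carrier_mat n k" and y: "y \<in> carrier_vec k"
  shows "U *\<^sub>v y \<in> W"
proof -
  interpret vec_space "TYPE(complex)" n .
  have "U *\<^sub>v y \<in> col_space U"
    using U y by (subst col_space_eq[OF U]) auto
  then show ?thesis
    using span_is_subset[OF cols is_subspace_dim_submodule[OF W]]
    unfolding col_space_def by auto
qed

text \<open>\<open>mat_inverse\<close> reports failure by the value \<open>None\<close>, about which \<open>the\<close> says nothing; invertibility
  is what gives \<open>the (mat_inverse M)\<close> a known shape.\<close>

lemma the_mat_inverse_carrier:
  fixes M :: "'a :: field mat"
  assumes M: "M \<in> carrier_mat k k" and inv: "invertible_mat M"
  shows "the (mat_inverse M) \<in> carrier_mat k k"
proof -
  from inv obtain B where B: "M * B = 1\<^sub>m k" "B * M = 1\<^sub>m (dim_row B)"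
    using M unfolding invertible_mat_def inverts_mat_def by auto
  \<comment> \<open>The two products force the shape of \<open>B\<close>: compare dimensions with the identities.\<close>
  have "dim_row B = k"
    using arg_cong[OF B(2), of dim_col] M by simp
  moreover have "dim_col B = k"
    using arg_cong[OF B(1), of dim_col] by simp
  ultimately have "M \<in> Units (ring_mat TYPE('a) k ())"
    using B M by (auto simp: Units_def ring_mat_def)
  with mat_inverse(1)[OF M, where b="()"] obtain C where "mat_inverse M = Some C"
    by (cases "mat_inverse M") auto
  with mat_inverse(2)[OF M this] show ?thesis
    by simp
qed

text \<open>\<open>\<Phi> x = A (U y)\<close> for the coefficient vector \<open>y = (Ut\<^sup>* A U)\<^sup>-\<^sup>1 Ut\<^sup>* x\<close>, and \<open>U y\<close> is a
  linear combination of basis vectors of \<open>W\<close>.\<close>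

lemma aug_Phi_range:
  assumes A: "A \<in> carrier_mat n n" and U: "U \<in> carrier_mat n k" and Ut: "Ut \<in> carrier_mat n k"
    and W: "is_subspace_dim n d W" and basis: "columns_form_basis n U W"
    and inv: "invertible_mat (mat_adjoint Ut * A * U)" and x: "x \<in> carrier_vec n"
  shows "aug_Phi A U Ut *\<^sub>v x \<in> mat_image A W"
proof -
  define S where "S = the (mat_inverse (mat_adjoint Ut * A * U))"
  define y where "y = S *\<^sub>v (mat_adjoint Ut *\<^sub>v x)"
  note Ut' = mat_adjoint_carrier[OF Ut]
  have S: "S \<in> carrier_mat k k"
    unfolding S_def using A U Ut' inv by (intro the_mat_inverse_carrier) auto
  have y: "y \<in> carrier_vec k"
    unfolding y_def using S Ut' x by auto
  have "aug_Phi A U Ut *\<^sub>v x = A * U * S * mat_adjoint Ut *\<^sub>v x"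
    unfolding aug_Phi_def S_def ..
  also have "\<dots> = A * U * S *\<^sub>v (mat_adjoint Ut *\<^sub>v x)"
    using A U S Ut' x by (intro assoc_mult_mat_vec) auto
  also have "\<dots> = A * U *\<^sub>v y"
    unfolding y_def using A U S Ut' x by (intro assoc_mult_mat_vec) auto
  also have "\<dots> = A *\<^sub>v (U *\<^sub>v y)"
    using A U y by (rule assoc_mult_mat_vec)
  finally show ?thesis
    using mult_mat_vec_in_subspace[OF W columns_form_basis_subset[OF W basis] U y]
    unfolding mat_image_def by auto
qed

lemma aug_Phi_carrier:
  assumes A: "A \<in> carrier_mat n n" and U: "U \<in> carrier_mat n k" and Ut: "Ut \<in> carrier_mat n k"
  shows "aug_Phi A U Ut \<in> carrier_mat n n"
  unfolding aug_Phi_def using A mat_adjoint_carrier[OF Ut]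
  by (intro carrier_matI) simp_all

theorem proposition4p2:
  fixes n k j :: nat
    and A U Ut :: "complex mat"
    and r0 w :: "complex vec"
    and Us Uts V Vt :: "complex vec set"
  assumes "A \<in> carrier_mat n n"
    and "r0 \<in> carrier_vec n"
    and "is_subspace_dim n k Us"
    and "is_subspace_dim n k Uts"
    and "w \<in> carrier_vec n"
    and "V = krylov_space n j A w"
    and "is_subspace_dim n j V"
    and "is_subspace_dim n j Vt"
    and "U \<in> carrier_mat n k"
    and "Ut \<in> carrier_mat n k"
    and "columns_form_basis n U Us"
    and "columns_form_basis n Ut Uts"
    and "invertible_mat (mat_adjoint Ut * A * U)"
    and "orth_set (mat_image A Us) Vt"
  shows "\<forall>t\<in>V.
           solves_problem A r0 V (mat_image (mat_adjoint (1\<^sub>m n - aug_Phi A U Ut)) Vt) t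
             \<longleftrightarrow> solves_problem A r0 V Vt t"
proof -
  note A = assms(1) and r0 = assms(2)
  define P where "P = aug_Phi A U Ut"
  have P: "P \<in> carrier_mat n n"
    unfolding P_def using assms by (intro aug_Phi_carrier)
  have Vt: "Vt \<subseteq> carrier_vec n"
    using assms(8) by (rule is_subspace_dim_carrier)
  have key: "orth_vec r (mat_image (mat_adjoint (1\<^sub>m n - P)) Vt) \<longleftrightarrow> orth_vec r Vt"
    if r: "r \<in> carrier_vec n" for r
  proof -
    have "P *\<^sub>v r \<in> mat_image A Us"
      unfolding P_def using assms r by (intro aug_Phi_range[where k=k and d=k])
    then have "orth_vec (P *\<^sub>v r) Vt"
      using assms(14) unfolding orth_set_def by auto
    then have "orth_vec (r - P *\<^sub>v r) Vt \<longleftrightarrow> orth_vec r Vt"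
      using r P Vt by (intro orth_vec_diff_iff[where n=n]) auto
    moreover have "(1\<^sub>m n - P) *\<^sub>v r = r - P *\<^sub>v r"
      using minus_mult_distrib_mat_vec[of "1\<^sub>m n" n n P r] P r by simp
    moreover have "1\<^sub>m n - P \<in> carrier_mat n n"
      using P by auto
    ultimately show ?thesis
      using orth_vec_mat_image_adjoint[OF _ r Vt] by simp
  qed
  have "r0 - A *\<^sub>v t \<in> carrier_vec n" if "t \<in> V" for t
  proof -
    have "t \<in> carrier_vec n"
      using that krylov_space_carrier[OF A assms(5)] assms(6) by blast
    with A r0 show ?thesis
      by (intro minus_carrier_vec mult_mat_vec_carrier)
  qed
  then show ?thesis
    unfolding solves_problem_def P_def[symmetric] using key by auto
qed

end
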